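(* Let $(X,\mathcal{A})$ be a measurable space with a measure $m$, and let $\mathcal{E}\colon L^2(X,m)\to[0,\infty]$ be a proper, lower semicontinuous functional. Then the following assertions are equivalent: (i) For all increasing normal contractions $p\colon\mathbb{R}\to\mathbb{R}$ and all $u,v\in L^2(X,m)$, $$\mathcal{E}(u-p(u-v))+\mathcal{E}(v+p(u-v))\leq\mathcal{E}(u)+\mathcal{E}(v).$$ (ii) $\mathcal{E}$ has the contraction property, i.e. for all normal contractions $C\colon\mathbb{R}\to\mathbb{R}$ and all $f,g\in L^2(X,m)$, $$\mathcal{E}(f+Cg)+\mathcal{E}(f-Cg)\leq\mathcal{E}(f+g)+\mathcal{E}(f-g).$$ (iii) $\mathcal{E}$ is a nonlinear Dirichlet form (in the sense of Cipriani / Grillo).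
   Context: $L^2(X,m)$ is the real Hilbert space of square-integrable functions. A functional $\mathcal{E}\colon L^2(X,m)\to[0,\infty]$ is proper if $\mathcal{E}(f)<\infty$ for some $f$. A normal contraction is a function $C\colon\mathbb{R}\to\mathbb{R}$ with $C(0)=0$ and $|C(x)-C(y)|\leq|x-y|$ for all $x,y\in\mathbb{R}$; $Cg$ (or $C(g)$) denotes the composition $C\circ g$. "Increasing" means non-decreasing. Notation: $a\wedge b=\min(a,b)$, $a\vee b=\max(a,b)$, $a_+=a\vee 0$, $a_-=(-a)\vee 0$, applied pointwise to functions. A functional $\mathcal{E}\colon L^2(X,m)\to[0,\infty]$ is a nonlinear Dirichlet form (in the sense of Cipriani / Grillo) if it is proper, lower semicontinuous and convex, and for all $u,v\in L^2(X,m)$ and all $\alpha>0$, $$\mathcal{E}\left(\frac{u+u\wedge v}{2}\right)+\mathcal{E}\left(\frac{v+u\vee v}{2}\right)\leq\mathcal{E}(u)+\mathcal{E}(v)$$ and $$\mathcal{E}(P^1_{2,\alpha}(u,v))+\mathcal{E}(P^2_{2,\alpha}(u,v))\leq\mathcal{E}(u)+\mathcal{E}(v),$$ where $P^1_{2,\alpha}(u,v)=v+\frac12[(u-v+\alpha)_+-(u-v-\alpha)_-]$ and $P^2_{2,\alpha}(u,v)=u-\frac12[(u-v+\alpha)_+-(u-v-\alpha)_-]$. *)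

theory Defs
  imports "HOL-Analysis.Analysis"
begin

text \<open>
  The measure space \<open>(X, \<A>, m)\<close> is a single value \<open>M :: 'a measure\<close> with
  \<open>X = space M\<close>. No finiteness assumption is made on it. Elements of \<open>L\<^sup>2(X, m)\<close>
  are represented by square-integrable functions; a functional on \<open>L\<^sup>2(X, m)\<close> is
  represented by a function on representatives that does not distinguish between
  functions that agree almost everywhere. Its values on functions that are not
  square-integrable are irrelevant: every quantifier below ranges over \<open>L2 M\<close>.
\<close>

definition L2 :: "'a measure \<Rightarrow> ('a \<Rightarrow> real) set" where
  "L2 M = {f \<in> borel_measurable M. integrable M (\<lambda>x. (f x)\<^sup>2)}"

definition L2_norm :: "'a measure \<Rightarrow> ('a \<Rightarrow> real) \<Rightarrow> real" where
  "L2_norm M f = sqrt (\<integral>x. (f x)\<^sup>2 \<partial>M)"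

definition L2_functional :: "'a measure \<Rightarrow> (('a \<Rightarrow> real) \<Rightarrow> ennreal) \<Rightarrow> bool" where
  "L2_functional M E \<longleftrightarrow>
     (\<forall>f\<in>L2 M. \<forall>g\<in>L2 M. (AE x in M. f x = g x) \<longrightarrow> E f = E g)"

definition proper_functional :: "'a measure \<Rightarrow> (('a \<Rightarrow> real) \<Rightarrow> ennreal) \<Rightarrow> bool" where
  "proper_functional M E \<longleftrightarrow> (\<exists>f\<in>L2 M. E f < \<infinity>)"

definition lsc_functional :: "'a measure \<Rightarrow> (('a \<Rightarrow> real) \<Rightarrow> ennreal) \<Rightarrow> bool" where
  "lsc_functional M E \<longleftrightarrow>
     (\<forall>f\<in>L2 M. \<forall>c < E f. \<exists>\<delta>>0. \<forall>g\<in>L2 M. L2_norm M (\<lambda>x. g x - f x) < \<delta> \<longrightarrow> c < E g)"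

definition convex_functional :: "'a measure \<Rightarrow> (('a \<Rightarrow> real) \<Rightarrow> ennreal) \<Rightarrow> bool" where
  "convex_functional M E \<longleftrightarrow>
     (\<forall>f\<in>L2 M. \<forall>g\<in>L2 M. \<forall>t\<in>{0..1::real}.
        E (\<lambda>x. (1 - t) * f x + t * g x) \<le> ennreal (1 - t) * E f + ennreal t * E g)"

definition normal_contraction :: "(real \<Rightarrow> real) \<Rightarrow> bool" where
  "normal_contraction C \<longleftrightarrow> C 0 = 0 \<and> (\<forall>x y. \<bar>C x - C y\<bar> \<le> \<bar>x - y\<bar>)"

definition contraction_property :: "'a measure \<Rightarrow> (('a \<Rightarrow> real) \<Rightarrow> ennreal) \<Rightarrow> bool" where
  "contraction_property M E \<longleftrightarrow>
     (\<forall>C. normal_contraction C \<longrightarrow> (\<forall>f\<in>L2 M. \<forall>g\<in>L2 M.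
        E (\<lambda>x. f x + C (g x)) + E (\<lambda>x. f x - C (g x))
          \<le> E (\<lambda>x. f x + g x) + E (\<lambda>x. f x - g x)))"

definition pos_part :: "real \<Rightarrow> real" where
  "pos_part a = max a 0"

definition neg_part :: "real \<Rightarrow> real" where
  "neg_part a = max (- a) 0"

definition P1 :: "real \<Rightarrow> ('a \<Rightarrow> real) \<Rightarrow> ('a \<Rightarrow> real) \<Rightarrow> 'a \<Rightarrow> real" where
  "P1 \<alpha> u v = (\<lambda>x. v x + 1/2 * (pos_part (u x - v x + \<alpha>) - neg_part (u x - v x - \<alpha>)))"

definition P2 :: "real \<Rightarrow> ('a \<Rightarrow> real) \<Rightarrow> ('a \<Rightarrow> real) \<Rightarrow> 'a \<Rightarrow> real" where
  "P2 \<alpha> u v = (\<lambda>x. u x - 1/2 * (pos_part (u x - v x + \<alpha>) - neg_part (u x - v x - \<alpha>)))"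

definition nonlinear_Dirichlet_form :: "'a measure \<Rightarrow> (('a \<Rightarrow> real) \<Rightarrow> ennreal) \<Rightarrow> bool" where
  "nonlinear_Dirichlet_form M E \<longleftrightarrow>
     proper_functional M E \<and> lsc_functional M E \<and> convex_functional M E \<and>
     (\<forall>u\<in>L2 M. \<forall>v\<in>L2 M.
        E (\<lambda>x. (u x + min (u x) (v x)) / 2) + E (\<lambda>x. (v x + max (u x) (v x)) / 2)
          \<le> E u + E v) \<and>
     (\<forall>u\<in>L2 M. \<forall>v\<in>L2 M. \<forall>\<alpha>>0. E (P1 \<alpha> u v) + E (P2 \<alpha> u v) \<le> E u + E v)"

end

theory Submission
  imports Defs "HOL-Library.Function_Algebras"
begin

text \<open>
  Call an increasing normal contraction \<open>p\<close> admissible if moving the amount \<open>p (u - v)\<close> from \<open>u\<close>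
  to \<open>v\<close> never increases \<open>E u + E v\<close>; assertion (i) says that all of them are admissible. The
  substitution \<open>u = f + g\<close>, \<open>v = f - g\<close>, \<open>C x = x - p (2 * x)\<close> is a bijection between increasing
  normal contractions \<open>p\<close> and normal contractions \<open>C\<close> (slopes in \<open>[0, 1]\<close> against slopes in
  \<open>[-1, 1]\<close>), so (i) and (ii) are the same condition.

  The two inequalities that define a nonlinear Dirichlet form are the admissibility of
  \<open>max x 0 / 2\<close> and of half the excess of \<open>x\<close> over its truncation to \<open>[-\<alpha>, \<alpha>]\<close>. Hence (i) implies
  (iii) once convexity is known. Taking \<open>p x = x / 2\<close> gives midpoint convexity, and \<open>p x = t * x\<close>
  bounds \<open>E\<close> along the segment from \<open>u\<close> to \<open>v\<close> by \<open>E u + E v\<close>; a bounded midpoint convex function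
  on an interval is convex.

  The implication from (iii) to (i) has three ingredients.

  First, the factor one half is removed (\<open>admissible_reflection\<close>). Halving projects the pair
  \<open>(u, v)\<close>, and the full transfer is the corresponding reflection. With \<open>d = p (u - v)\<close>,
  \<open>A t = E (v + t * d)\<close> and \<open>B t = E (u - d + t * d)\<close>, the halved inequality along the two segments
  reads \<open>A s - A (s - h) \<le> B (s + h) - B s\<close>: every increment of \<open>A\<close> is at most a later increment of
  \<open>B\<close>. Summing over dyadic steps yields \<open>A 1 - A 0 \<le> B 1 - B 0\<close> up to an error that
  lower semicontinuity absorbs.

  Second, admissible transfers can be pasted together at a point \<open>b\<close>
  (\<open>admissible_concatenation\<close>). Cut \<open>u - v\<close> at height \<open>b\<close> and let \<open>p\<close> act below and \<open>q\<close> act above.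
  This splits \<open>u - v\<close> into four functions, and the value of \<open>E\<close> at \<open>v\<close> plus a subset of them is a
  set function with increasing marginals, because any two of the four are separated by an
  admissible transfer.

  Third, linear transfers \<open>c * x\<close> are admissible by convexity, so pasting gives all piecewise
  linear increasing contractions, and these converge pointwise to the general one. Dominated
  convergence and lower semicontinuity pass the inequality to the limit.
\<close>

section \<open>Square-integrable functions and normal contractions\<close>

lemma L2_add:
  assumes "f \<in> L2 M" "g \<in> L2 M"
  shows "f + g \<in> L2 M"
proof -
  have [measurable]: "f \<in> borel_measurable M" "g \<in> borel_measurable M"
    using assms by (auto simp: L2_def)
  have "integrable M (\<lambda>x. 2 * (f x)\<^sup>2 + 2 * (g x)\<^sup>2)"
    using assms by (auto simp: L2_def)
  moreover have "(f x + g x)\<^sup>2 \<le> 2 * (f x)\<^sup>2 + 2 * (g x)\<^sup>2" for x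
    using zero_le_power2[of "f x - g x"] by (simp add: power2_eq_square algebra_simps)
  ultimately have "integrable M (\<lambda>x. (f x + g x)\<^sup>2)"
    by (intro Bochner_Integration.integrable_bound[of M _ "\<lambda>x. (f x + g x)\<^sup>2"]) auto
  then show ?thesis
    by (simp add: L2_def plus_fun_def)
qed

lemma L2_scale: "f \<in> L2 M \<Longrightarrow> (\<lambda>x. c * f x) \<in> L2 M"
  by (auto simp: L2_def power_mult_distrib intro!: borel_measurable_times)

lemma L2_diff:
  assumes "f \<in> L2 M" "g \<in> L2 M"
  shows "f - g \<in> L2 M"
  using L2_add[OF assms(1) L2_scale[OF assms(2), of "-1"]]
  by (simp add: plus_fun_def fun_diff_def)

lemma normal_contractionI:
  assumes "p 0 = 0" "\<And>x y. x \<le> y \<Longrightarrow> \<bar>p y - p x\<bar> \<le> y - x"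
  shows "normal_contraction p"
  unfolding normal_contraction_def
proof (intro conjI allI)
  show "\<bar>p x - p y\<bar> \<le> \<bar>x - y\<bar>" for x y
    using assms(2)[of x y] assms(2)[of y x] by (cases "x \<le> y") auto
qed (use assms in auto)

lemma normal_contraction_zero: "normal_contraction p \<Longrightarrow> p 0 = 0"
  by (simp add: normal_contraction_def)

lemma normal_contraction_dist: "normal_contraction p \<Longrightarrow> \<bar>p x - p y\<bar> \<le> \<bar>x - y\<bar>"
  by (simp add: normal_contraction_def)

lemma normal_contraction_abs_le: "normal_contraction p \<Longrightarrow> \<bar>p x\<bar> \<le> \<bar>x\<bar>"
  using normal_contraction_dist[of p x 0] by (simp add: normal_contraction_zero)

lemma mono_contractionD:
  assumes "mono p" "normal_contraction p" "x \<le> y"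
  shows "p x \<le> p y" "p y - p x \<le> y - x"
  using monoD[OF assms(1,3)] normal_contraction_dist[OF assms(2), of y x] assms(3) by auto

lemma mono_contractionI:
  assumes "p 0 = 0" "\<And>x y. x \<le> y \<Longrightarrow> p x \<le> p y \<and> p y - p x \<le> y - x"
  shows "mono p \<and> normal_contraction p"
proof
  show "mono p"
    using assms(2) by (auto intro: monoI)
  show "normal_contraction p"
    using assms by (intro normal_contractionI) auto
qed

lemma mono_contraction_linear:
  assumes "0 \<le> c" "c \<le> 1"
  shows "mono (\<lambda>x. c * x) \<and> normal_contraction (\<lambda>x. c * x)"
proof (rule mono_contractionI)
  show "c * x \<le> c * y \<and> c * y - c * x \<le> y - x" if "x \<le> y" for x y
    using assms that mult_right_mono[of c 1 "y - x"] by (auto simp: mult_left_mono right_diff_distrib)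
qed simp

lemma mono_contraction_concatenation:
  assumes p: "mono p" "normal_contraction p" and q: "mono q" "normal_contraction q" and b: "0 \<le> b"
  shows "mono (\<lambda>x. p (min x b) + q (max (x - b) 0)) \<and>
    normal_contraction (\<lambda>x. p (min x b) + q (max (x - b) 0))"
proof (rule mono_contractionI)
  show "p (min 0 b) + q (max (0 - b) 0) = 0"
    using b p q by (simp add: normal_contraction_zero)
  fix x y :: real assume "x \<le> y"
  then have le: "min x b \<le> min y b" "max (x - b) 0 \<le> max (y - b) 0"
    by auto
  have sum: "min x b + max (x - b) 0 = x" "min y b + max (y - b) 0 = y"
    by (auto simp: min_def max_def)
  show "p (min x b) + q (max (x - b) 0) \<le> p (min y b) + q (max (y - b) 0) \<and>
    p (min y b) + q (max (y - b) 0) - (p (min x b) + q (max (x - b) 0)) \<le> y - x"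
    using mono_contractionD[OF p le(1)] mono_contractionD[OF q le(2)] sum by linarith
qed

lemma mono_contraction_mirror:
  assumes "mono p" "normal_contraction p"
  shows "mono (\<lambda>x. - p (- x)) \<and> normal_contraction (\<lambda>x. - p (- x))"
proof (rule mono_contractionI)
  show "- p (- x) \<le> - p (- y) \<and> - p (- y) - - p (- x) \<le> y - x" if "x \<le> y" for x y
    using mono_contractionD[OF assms, of "- y" "- x"] that by auto
qed (use assms in \<open>simp add: normal_contraction_zero\<close>)

lemma normal_contraction_cuts:
  "b \<ge> 0 \<Longrightarrow> normal_contraction (\<lambda>x. min x b)"
  "b \<ge> 0 \<Longrightarrow> normal_contraction (\<lambda>x. max (x - b) 0)"
  by (auto intro!: normal_contractionI)

lemma normal_contraction_measurable:
  assumes "normal_contraction p"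
  shows "p \<in> borel_measurable borel"
proof (rule borel_measurable_continuous_onI)
  have "1-lipschitz_on UNIV p"
    using assms by (auto intro!: lipschitz_onI simp: dist_real_def normal_contraction_dist)
  then show "continuous_on UNIV p"
    by (rule lipschitz_on_continuous_on)
qed

lemma L2_contraction:
  assumes "normal_contraction p" "f \<in> L2 M"
  shows "(\<lambda>x. p (f x)) \<in> L2 M"
proof -
  note [measurable] = normal_contraction_measurable[OF assms(1)]
  have [measurable]: "f \<in> borel_measurable M"
    using assms by (auto simp: L2_def)
  have "(p (f x))\<^sup>2 \<le> (f x)\<^sup>2" for x
    using normal_contraction_abs_le[OF assms(1)] by (simp add: abs_le_square_iff)
  moreover have "integrable M (\<lambda>x. (f x)\<^sup>2)"
    using assms(2) by (simp add: L2_def)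
  ultimately have "integrable M (\<lambda>x. (p (f x))\<^sup>2)"
    by (intro Bochner_Integration.integrable_bound[of M "\<lambda>x. (f x)\<^sup>2" "\<lambda>x. (p (f x))\<^sup>2"]) auto
  then show ?thesis
    unfolding L2_def by simp
qed

section \<open>Passing to the limit\<close>

lemma L2_norm_dominated_tendsto_0:
  assumes f: "f \<in> L2 M" and fn: "\<And>n. fn n \<in> L2 M" and k: "k \<in> L2 M"
    and lim: "\<And>x. (\<lambda>n. fn n x) \<longlonglongrightarrow> f x"
    and bound: "\<And>n x. \<bar>fn n x - f x\<bar> \<le> \<bar>k x\<bar>"
  shows "(\<lambda>n. L2_norm M (\<lambda>x. fn n x - f x)) \<longlonglongrightarrow> 0"
proof -
  have [measurable]: "f \<in> borel_measurable M" "\<And>n. fn n \<in> borel_measurable M"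
    using f fn by (auto simp: L2_def)
  have "(\<lambda>n. \<integral>x. (fn n x - f x)\<^sup>2 \<partial>M) \<longlonglongrightarrow> (\<integral>x. 0 \<partial>M)"
  proof (rule integral_dominated_convergence[where w = "\<lambda>x. (k x)\<^sup>2"])
    show "integrable M (\<lambda>x. (k x)\<^sup>2)"
      using k by (simp add: L2_def)
    have "(\<lambda>n. (fn n x - f x)\<^sup>2) \<longlonglongrightarrow> (f x - f x)\<^sup>2" for x
      by (intro tendsto_intros lim)
    then show "AE x in M. (\<lambda>n. (fn n x - f x)\<^sup>2) \<longlonglongrightarrow> 0"
      by simp
    show "AE x in M. norm ((fn n x - f x)\<^sup>2) \<le> (k x)\<^sup>2" for n
      using bound by (simp add: abs_le_square_iff)
  qed auto
  from tendsto_real_sqrt[OF this] show ?thesis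
    by (simp add: L2_norm_def)
qed

lemma lsc_le_liminf:
  assumes "lsc_functional M E" "f \<in> L2 M" "\<And>n. fn n \<in> L2 M"
    and "(\<lambda>n. L2_norm M (\<lambda>x. fn n x - f x)) \<longlonglongrightarrow> 0"
  shows "E f \<le> liminf (\<lambda>n. E (fn n))"
  unfolding le_Liminf_iff
proof (intro allI impI)
  fix c assume "c < E f"
  then obtain \<delta> where "\<delta> > 0" "\<And>g. g \<in> L2 M \<Longrightarrow> L2_norm M (\<lambda>x. g x - f x) < \<delta> \<Longrightarrow> c < E g"
    using assms(1,2) unfolding lsc_functional_def by blast
  with order_tendstoD(2)[OF assms(4) this(1)] show "\<forall>\<^sub>F n in sequentially. c < E (fn n)"
    using assms(3) by (auto elim: eventually_mono)
qed

text \<open>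
  The liminf is superadditive: it is a supremum of the increasing sequence of tail infima, and such
  suprema commute with addition.
\<close>

lemma liminf_add_le_bound:
  fixes a b :: "nat \<Rightarrow> ennreal"
  assumes "\<And>n. a n + b n \<le> K"
  shows "liminf a + liminf b \<le> K"
proof -
  have mono: "incseq (\<lambda>n. INF m\<in>{n..}. c m)" for c :: "nat \<Rightarrow> ennreal"
    by (auto intro!: INF_superset_mono monoI)
  have "liminf a + liminf b = (SUP n. (INF m\<in>{n..}. a m) + (INF m\<in>{n..}. b m))"
    unfolding liminf_SUP_INF by (rule ennreal_SUP_add[symmetric]; rule mono)
  also have "\<dots> \<le> (SUP n. a n + b n)"
    by (intro SUP_mono' add_mono INF_lower) auto
  also have "\<dots> \<le> K"
    using assms by (auto intro: SUP_least)
  finally show ?thesis .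
qed

text \<open>
  Pointwise domination by a fixed \<open>L\<^sup>2\<close> function is the form in which convergence arises below, both
  for segments \<open>w + t * d\<close> with varying \<open>t\<close> and for transfers with varying contraction.
\<close>

lemma lsc_sum_limit:
  assumes lsc: "lsc_functional M E" and k: "k \<in> L2 M"
    and f: "f \<in> L2 M" "\<And>n. fn n \<in> L2 M" "\<And>x. (\<lambda>n. fn n x) \<longlonglongrightarrow> f x"
      "\<And>n x. \<bar>fn n x - f x\<bar> \<le> \<bar>k x\<bar>"
    and g: "g \<in> L2 M" "\<And>n. gn n \<in> L2 M" "\<And>x. (\<lambda>n. gn n x) \<longlonglongrightarrow> g x"
      "\<And>n x. \<bar>gn n x - g x\<bar> \<le> \<bar>k x\<bar>"
    and bound: "\<And>n. E (fn n) + E (gn n) \<le> K"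
  shows "E f + E g \<le> K"
proof -
  have "E f \<le> liminf (\<lambda>n. E (fn n))"
    by (intro lsc_le_liminf[OF lsc] L2_norm_dominated_tendsto_0[OF _ _ k] f)
  moreover have "E g \<le> liminf (\<lambda>n. E (gn n))"
    by (intro lsc_le_liminf[OF lsc] L2_norm_dominated_tendsto_0[OF _ _ k] g)
  ultimately have "E f + E g \<le> liminf (\<lambda>n. E (fn n)) + liminf (\<lambda>n. E (gn n))"
    by (rule add_mono)
  also have "\<dots> \<le> K"
    using bound by (rule liminf_add_le_bound)
  finally show ?thesis .
qed

section \<open>Admissible transfers\<close>

definition admissible_transfer ::
    "'a measure \<Rightarrow> (('a \<Rightarrow> real) \<Rightarrow> ennreal) \<Rightarrow> (real \<Rightarrow> real) \<Rightarrow> bool" where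
  "admissible_transfer M E p \<longleftrightarrow> (\<forall>u\<in>L2 M. \<forall>v\<in>L2 M.
     E (\<lambda>x. u x - p (u x - v x)) + E (\<lambda>x. v x + p (u x - v x)) \<le> E u + E v)"

lemma admissible_transferD:
  assumes "admissible_transfer M E p" "u \<in> L2 M" "v \<in> L2 M"
  shows "E (\<lambda>x. u x - p (u x - v x)) + E (\<lambda>x. v x + p (u x - v x)) \<le> E u + E v"
  using assms by (simp add: admissible_transfer_def)

text \<open>
  The inequality as supermodularity: over any base point \<open>w\<close>, the increment of \<open>E\<close> in
  direction \<open>e\<close> can only grow when \<open>d\<close> has been added before. An admissible \<open>p\<close> that recovers \<open>d\<close>
  from \<open>d + e\<close> is all that is needed, whatever \<open>w\<close> is.
\<close>

lemma admissible_split: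
  assumes "admissible_transfer M E p" "w \<in> L2 M" "d \<in> L2 M" "e \<in> L2 M"
    and "\<And>x. p (d x + e x) = d x"
  shows "E (w + d) + E (w + e) \<le> E w + E (w + d + e)"
  using admissible_transferD[OF assms(1), of "w + d + e" w] assms(2-)
  by (simp add: L2_add add.assoc) (simp add: plus_fun_def add_ac)

text \<open>
  Transferring \<open>x - p x\<close> leads to the same two functions with their roles exchanged.
\<close>

lemma admissible_complement:
  assumes "admissible_transfer M E p"
  shows "admissible_transfer M E (\<lambda>x. x - p x)"
  using assms by (simp add: admissible_transfer_def algebra_simps)

text \<open>
  This is the inequality for the pair with \<open>u\<close> and \<open>v\<close> exchanged.
\<close>

lemma admissible_mirror:
  assumes "admissible_transfer M E p"
  shows "admissible_transfer M E (\<lambda>x. - p (- x))"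
  unfolding admissible_transfer_def
proof (intro ballI)
  fix u v assume "u \<in> L2 M" "v \<in> L2 M"
  from admissible_transferD[OF assms this(2,1)]
  show "E (\<lambda>x. u x - - p (- (u x - v x))) + E (\<lambda>x. v x + - p (- (u x - v x))) \<le> E u + E v"
    by (simp add: add.commute)
qed

lemma admissible_id: "admissible_transfer M E (\<lambda>x. x)"
  by (simp add: admissible_transfer_def add.commute)

lemma admissible_limit:
  assumes lsc: "lsc_functional M E" and p: "normal_contraction p"
    and q: "\<And>n. normal_contraction (q n)" "\<And>n. admissible_transfer M E (q n)"
    and lim: "\<And>x. (\<lambda>n. q n x) \<longlonglongrightarrow> p x"
  shows "admissible_transfer M E p"
  unfolding admissible_transfer_def
proof (intro ballI)
  fix u v assume uv: "u \<in> L2 M" "v \<in> L2 M"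
  have L2_r: "(\<lambda>x. r (u x - v x)) \<in> L2 M" if "normal_contraction r" for r
    using L2_contraction[OF that L2_diff[OF uv]] by simp
  have dom: "\<bar>q n y - p y\<bar> \<le> \<bar>2 * y\<bar>" for n y
    using normal_contraction_abs_le[OF p, of y] normal_contraction_abs_le[OF q(1), of n y] by simp
  show "E (\<lambda>x. u x - p (u x - v x)) + E (\<lambda>x. v x + p (u x - v x)) \<le> E u + E v"
  proof (rule lsc_sum_limit[OF lsc, where k = "\<lambda>x. 2 * (u x - v x)"
        and fn = "\<lambda>n x. u x - q n (u x - v x)" and gn = "\<lambda>n x. v x + q n (u x - v x)"])
    show "(\<lambda>x. 2 * (u x - v x)) \<in> L2 M"
      using L2_scale[OF L2_diff[OF uv], of 2] unfolding fun_diff_def .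
    show "(\<lambda>x. u x - p (u x - v x)) \<in> L2 M" "(\<lambda>x. u x - q n (u x - v x)) \<in> L2 M" for n
      using L2_diff[OF uv(1) L2_r[OF p]] L2_diff[OF uv(1) L2_r[OF q(1)]] by (simp_all add: fun_diff_def)
    show "(\<lambda>x. v x + p (u x - v x)) \<in> L2 M" "(\<lambda>x. v x + q n (u x - v x)) \<in> L2 M" for n
      using L2_add[OF uv(2) L2_r[OF p]] L2_add[OF uv(2) L2_r[OF q(1)]] by (simp_all add: plus_fun_def)
    show "(\<lambda>n. u x - q n (u x - v x)) \<longlonglongrightarrow> u x - p (u x - v x)"
      "(\<lambda>n. v x + q n (u x - v x)) \<longlonglongrightarrow> v x + p (u x - v x)" for x
      by (intro tendsto_intros lim)+
    show "\<bar>u x - q n (u x - v x) - (u x - p (u x - v x))\<bar> \<le> \<bar>2 * (u x - v x)\<bar>"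
      "\<bar>v x + q n (u x - v x) - (v x + p (u x - v x))\<bar> \<le> \<bar>2 * (u x - v x)\<bar>" for n x
      using dom[of n "u x - v x"] by auto
    show "E (\<lambda>x. u x - q n (u x - v x)) + E (\<lambda>x. v x + q n (u x - v x)) \<le> E u + E v" for n
      by (rule admissible_transferD[OF q(2) uv])
  qed
qed

text \<open>
  Both new functions lie on the segment from \<open>u\<close> to \<open>v\<close>, at complementary positions, so the two
  convexity bounds add up to \<open>E u + E v\<close>.
\<close>

lemma admissible_linear:
  assumes cvx: "convex_functional M E" and c: "0 \<le> c" "c \<le> 1"
  shows "admissible_transfer M E (\<lambda>x. c * x)"
  unfolding admissible_transfer_def
proof (intro ballI)
  fix u v assume uv: "u \<in> L2 M" "v \<in> L2 M"
  have segment: "E (\<lambda>x. (1 - c) * f x + c * g x) \<le> ennreal (1 - c) * E f + ennreal c * E g"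
    if "f \<in> L2 M" "g \<in> L2 M" for f g
    using cvx c that by (simp add: convex_functional_def)
  have "E (\<lambda>x. u x - c * (u x - v x)) + E (\<lambda>x. v x + c * (u x - v x))
      \<le> (ennreal (1 - c) * E u + ennreal c * E v) + (ennreal (1 - c) * E v + ennreal c * E u)"
    using add_mono[OF segment[OF uv] segment[OF uv(2,1)]] by (simp add: algebra_simps)
  also have "\<dots> = (ennreal (1 - c) + ennreal c) * (E u + E v)"
    by (simp add: algebra_simps)
  also have "ennreal (1 - c) + ennreal c = 1"
    using c by (simp flip: ennreal_plus)
  finally show "E (\<lambda>x. u x - c * (u x - v x)) + E (\<lambda>x. v x + c * (u x - v x)) \<le> E u + E v"
    by simp
qed

section \<open>From projections to reflections\<close>

text \<open>
  Doubling the number of steps halves the distance to the reflection, which would be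
  \<open>A (s + h) + B s\<close>. The induction step applies the claim to both halves \<open>[s, m]\<close> and \<open>[m, s + h]\<close>
  of the interval. Adding these leaves the unwanted terms \<open>A (m - \<epsilon>*h/2) + B (m + \<epsilon>*h/2)\<close>, which
  the hypothesis \<open>half\<close>, used on a short interval around \<open>m\<close>, bounds below by \<open>A m + B m\<close>; that
  sum then cancels.
\<close>

lemma dyadic_reflection:
  fixes A B :: "real \<Rightarrow> ennreal"
  assumes half: "\<And>s h. 0 \<le> s \<Longrightarrow> 0 \<le> h \<Longrightarrow> s + h \<le> 1 \<Longrightarrow>
      A (s + h/2) + B (s + h/2) \<le> A s + B (s + h)"
    and "0 \<le> s" "0 \<le> h" "s + h \<le> 1"
  shows "A (s + (1 - (1/2)^Suc n) * h) + B (s + (1/2)^Suc n * h) \<le> A s + B (s + h)"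
  using assms(2-)
proof (induction n arbitrary: s h)
  case 0
  then show ?case
    using half[of s h] by simp
next
  case (Suc n)
  define \<epsilon> :: real where "\<epsilon> = (1/2)^Suc n"
  have \<epsilon>: "0 \<le> \<epsilon>" "\<epsilon> \<le> 1"
    unfolding \<epsilon>_def by (auto intro!: power_le_one simp del: power_Suc)
  have \<epsilon>h: "0 \<le> \<epsilon> * h" "\<epsilon> * h \<le> h"
    using \<epsilon> Suc.prems mult_right_mono[of \<epsilon> 1 h] by auto
  define m where "m = s + h/2"
  show ?case
  proof (cases "A s + B (s + h) = \<infinity>")
    case False
    \<comment> \<open>This makes \<open>A m + B m\<close> finite, which the final cancellation requires.\<close>
    have outer: "A m + B m \<le> A s + B (s + h)"
      unfolding m_def by (rule half) (use Suc.prems in auto)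
    have left: "A (m - \<epsilon>*h/2) + B (s + \<epsilon>*h/2) \<le> A s + B m"
      using Suc.IH[of s "h/2"] Suc.prems
      by (simp add: \<epsilon>_def[symmetric] m_def algebra_simps diff_divide_distrib del: power_Suc)
    have right: "A (s + (1 - \<epsilon>/2) * h) + B (m + \<epsilon>*h/2) \<le> A m + B (s + h)"
    proof -
      have "m + (1 - \<epsilon>) * (h/2) = s + (1 - \<epsilon>/2) * h" "m + \<epsilon> * (h/2) = m + \<epsilon>*h/2" "m + h/2 = s + h"
        by (simp_all add: m_def field_simps)
      moreover have "A (m + (1 - \<epsilon>) * (h/2)) + B (m + \<epsilon> * (h/2)) \<le> A m + B (m + h/2)"
        unfolding \<epsilon>_def by (rule Suc.IH) (use Suc.prems in \<open>auto simp: m_def\<close>)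
      ultimately show ?thesis
        by (simp only:)
    qed
    have inner: "A m + B m \<le> A (m - \<epsilon>*h/2) + B (m + \<epsilon>*h/2)"
      using half[of "m - \<epsilon>*h/2" "\<epsilon>*h"] Suc.prems \<epsilon>h by (simp add: m_def algebra_simps)
    have "(A m + B m) + (A (s + (1 - \<epsilon>/2) * h) + B (s + \<epsilon>/2 * h))
        \<le> (A (m - \<epsilon>*h/2) + B (m + \<epsilon>*h/2)) + (A (s + (1 - \<epsilon>/2) * h) + B (s + \<epsilon>*h/2))"
      by (rule add_mono[OF inner]) simp
    also have "\<dots> = (A (m - \<epsilon>*h/2) + B (s + \<epsilon>*h/2)) + (A (s + (1 - \<epsilon>/2) * h) + B (m + \<epsilon>*h/2))"
      by (simp add: ac_simps)
    also have "\<dots> \<le> (A s + B m) + (A m + B (s + h))"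
      by (rule add_mono[OF left right])
    also have "\<dots> = (A m + B m) + (A s + B (s + h))"
      by (simp add: ac_simps)
    finally have "A (s + (1 - \<epsilon>/2) * h) + B (s + \<epsilon>/2 * h) \<le> A s + B (s + h)"
      using False outer unfolding ennreal_add_left_cancel_le infinity_ennreal_def by (metis top_unique)
    then show ?thesis
      by (simp add: \<epsilon>_def)
  qed (simp only: infinity_ennreal_def top_greatest)
qed

text \<open>
  The hypothesis \<open>retract\<close> says that \<open>p\<close> extracts exactly \<open>h * p x\<close> after the part \<open>p x\<close> of \<open>x\<close>
  has been scaled by \<open>h\<close>. So, writing \<open>d = p (u - v)\<close>, a halved transfer between the points at
  parameter \<open>s\<close> and \<open>s + h\<close> of the two segments in direction \<open>d\<close> moves both to the parameter
  \<open>s + h/2\<close>.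
\<close>

lemma admissible_reflection:
  assumes lsc: "lsc_functional M E" and p: "normal_contraction p"
    and half: "admissible_transfer M E (\<lambda>x. p x / 2)"
    and retract: "\<And>x h. 0 \<le> h \<Longrightarrow> h \<le> 1 \<Longrightarrow> p (x - p x + h * p x) = h * p x"
  shows "admissible_transfer M E p"
  unfolding admissible_transfer_def
proof (intro ballI)
  fix u v assume uv: "u \<in> L2 M" "v \<in> L2 M"
  define d where "d = (\<lambda>x. p (u x - v x))"
  have d: "d \<in> L2 M"
    unfolding d_def using L2_contraction[OF p L2_diff[OF uv]] by simp
  define A where "A t = (\<lambda>x. v x + t * d x)" for t
  define B where "B t = (\<lambda>x. u x - d x + t * d x)" for t
  have A: "A t \<in> L2 M" for t
    using L2_add[OF uv(2) L2_scale[OF d]] by (simp add: A_def plus_fun_def)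
  have B: "B t \<in> L2 M" for t
    using L2_add[OF L2_diff[OF uv(1) d] L2_scale[OF d]] by (simp add: B_def plus_fun_def)
  have step: "E (A (s + h/2)) + E (B (s + h/2)) \<le> E (A s) + E (B (s + h))"
    if "0 \<le> s" "0 \<le> h" "s + h \<le> 1" for s h
  proof -
    have "p (B (s + h) x - A s x) = h * d x" for x
      using retract[of h "u x - v x"] that by (simp add: A_def B_def d_def algebra_simps)
    then have "A (s + h/2) = (\<lambda>x. A s x + p (B (s + h) x - A s x) / 2)"
      "B (s + h/2) = (\<lambda>x. B (s + h) x - p (B (s + h) x - A s x) / 2)"
      by (simp_all add: fun_eq_iff) (simp_all add: A_def B_def algebra_simps)
    then show ?thesis
      using admissible_transferD[OF half B[of "s + h"] A[of s]] by (simp add: add.commute)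
  qed
  define \<epsilon> :: "nat \<Rightarrow> real" where "\<epsilon> n = (1/2)^Suc n" for n
  have \<epsilon>: "0 \<le> \<epsilon> n" "\<epsilon> n \<le> 1" for n
    unfolding \<epsilon>_def by (auto intro!: power_le_one simp del: power_Suc)
  have \<epsilon>_lim: "\<epsilon> \<longlonglongrightarrow> 0"
    unfolding \<epsilon>_def by (intro LIMSEQ_Suc LIMSEQ_power_zero) simp
  have "E (B 0) + E (A 1) \<le> E u + E v"
  proof (rule lsc_sum_limit[OF lsc d, where fn = "\<lambda>n. B (\<epsilon> n)" and gn = "\<lambda>n. A (1 - \<epsilon> n)"])
    have "(\<lambda>n. u x - d x + \<epsilon> n * d x) \<longlonglongrightarrow> u x - d x + 0 * d x" for x
      by (intro tendsto_intros \<epsilon>_lim)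
    then show "(\<lambda>n. B (\<epsilon> n) x) \<longlonglongrightarrow> B 0 x" for x
      by (simp add: B_def)
    have "(\<lambda>n. v x + (1 - \<epsilon> n) * d x) \<longlonglongrightarrow> v x + (1 - 0) * d x" for x
      by (intro tendsto_intros \<epsilon>_lim)
    then show "(\<lambda>n. A (1 - \<epsilon> n) x) \<longlonglongrightarrow> A 1 x" for x
      by (simp add: A_def)
    have "\<bar>\<epsilon> n * d x\<bar> \<le> \<bar>d x\<bar>" for n x
      using \<epsilon>[of n] by (simp add: abs_mult mult_left_le_one_le)
    then show "\<bar>B (\<epsilon> n) x - B 0 x\<bar> \<le> \<bar>d x\<bar>" "\<bar>A (1 - \<epsilon> n) x - A 1 x\<bar> \<le> \<bar>d x\<bar>" for n x
      by (simp_all add: A_def B_def left_diff_distrib)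
    show "E (B (\<epsilon> n)) + E (A (1 - \<epsilon> n)) \<le> E u + E v" for n
      using dyadic_reflection[of "\<lambda>t. E (A t)" "\<lambda>t. E (B t)" 0 1 n, OF step]
      by (simp add: \<epsilon>_def[symmetric] add.commute del: power_Suc) (simp add: A_def B_def add.commute)
  qed (rule A B)+
  then show "E (\<lambda>x. u x - p (u x - v x)) + E (\<lambda>x. v x + p (u x - v x)) \<le> E u + E v"
    by (simp add: A_def B_def d_def)
qed

section \<open>Concatenating transfers\<close>

text \<open>
  Cancelling in a chain of inequalities between sums needs finiteness of the cancelled terms. The
  next two rules derive that finiteness together with the real inequality, so that linear
  arithmetic can do the cancellation.
\<close>

lemma ennreal_sum_leD:
  fixes a b c d :: ennreal
  assumes "a + b \<le> c + d" "c < \<infinity>" "d < \<infinity>"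
  shows "a < \<infinity>" "b < \<infinity>" "enn2real a + enn2real b \<le> enn2real c + enn2real d"
proof -
  have fin: "c + d < \<infinity>"
    using assms by simp
  then have ab: "a + b < \<infinity>"
    using assms(1) by (rule le_less_trans[rotated])
  then show "a < \<infinity>" "b < \<infinity>"
    by auto
  have "enn2real (a + b) \<le> enn2real (c + d)"
    using assms(1) fin by (intro enn2real_mono) auto
  then show "enn2real a + enn2real b \<le> enn2real c + enn2real d"
    using ab assms(2,3) by (simp add: enn2real_plus)
qed

lemma ennreal_sum_leI:
  fixes a b c d :: ennreal
  assumes "a < \<infinity>" "b < \<infinity>" "c < \<infinity>" "d < \<infinity>"
    and "enn2real a + enn2real b \<le> enn2real c + enn2real d"
  shows "a + b \<le> c + d"
proof -
  have "a + b = ennreal (enn2real a + enn2real b)" "c + d = ennreal (enn2real c + enn2real d)"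
    using assms(1-4) by simp_all
  then show ?thesis
    using assms(5) by (simp only: ennreal_leI)
qed

text \<open>
  Let \<open>l + r\<close> be the decomposition of \<open>u - v\<close> at height \<open>b\<close>, and split \<open>l = a + a'\<close> by \<open>p\<close> and
  \<open>r = d + d'\<close> by \<open>q\<close>. The claim is supermodularity for the pair \<open>a + d\<close>, \<open>a' + d'\<close>, and it follows
  by combining supermodularity for single pieces. The pairs \<open>a, a'\<close> and \<open>d, d'\<close> are separated by
  \<open>p\<close> and \<open>q\<close>. A lower and an upper piece are separated by a cut \<open>min x \<beta>\<close>, because the lower
  piece has reached its maximal value wherever the upper one is nonzero; \<open>\<beta>\<close> is that maximal
  value: \<open>b\<close> for \<open>l\<close>, \<open>p b\<close> for \<open>a\<close>, and \<open>b - p b\<close> for \<open>a'\<close>.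
\<close>

lemma admissible_concatenation:
  assumes p: "mono p" "normal_contraction p" "admissible_transfer M E p"
    and q: "mono q" "normal_contraction q" "admissible_transfer M E q"
    and b: "0 \<le> b"
    and cut: "\<And>\<beta>. 0 \<le> \<beta> \<Longrightarrow> \<beta> \<le> b \<Longrightarrow> admissible_transfer M E (\<lambda>x. min x \<beta>)"
  shows "admissible_transfer M E (\<lambda>x. p (min x b) + q (max (x - b) 0))"
  unfolding admissible_transfer_def
proof (intro ballI)
  fix u v assume uv: "u \<in> L2 M" "v \<in> L2 M"
  define w where "w = (\<lambda>x. u x - v x)"
  define l where "l = (\<lambda>x. min (w x) b)"
  define r where "r = (\<lambda>x. max (w x - b) 0)"
  define a where "a = (\<lambda>x. p (l x))"
  define a' where "a' = (\<lambda>x. l x - p (l x))"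
  define d where "d = (\<lambda>x. q (r x))"
  define d' where "d' = (\<lambda>x. r x - q (r x))"
  have w: "w \<in> L2 M"
    using L2_diff[OF uv] by (simp add: w_def fun_diff_def)
  have l: "l \<in> L2 M" and r: "r \<in> L2 M"
    unfolding l_def r_def
    using L2_contraction[OF normal_contraction_cuts(1)[OF b] w]
      L2_contraction[OF normal_contraction_cuts(2)[OF b] w] by simp_all
  have a: "a \<in> L2 M" and d: "d \<in> L2 M"
    unfolding a_def d_def by (rule L2_contraction[OF p(2) l] L2_contraction[OF q(2) r])+
  have a': "a' \<in> L2 M" and d': "d' \<in> L2 M"
    using L2_diff[OF l a] L2_diff[OF r d] by (simp_all add: a_def a'_def d_def d'_def fun_diff_def)
  note L2 = uv(2) a a' d d' l r
  have lr_w: "l x + r x = u x - v x" for x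
    by (simp add: l_def r_def w_def min_def max_def)
  have sums: "a + a' = l" "d + d' = r" "v + l + r = u"
    using lr_w by (simp_all add: fun_eq_iff a_def a'_def d_def d'_def add.assoc)
  have targets: "(\<lambda>x. v x + (p (min (u x - v x) b) + q (max (u x - v x - b) 0))) = v + a + d"
    "(\<lambda>x. u x - (p (min (u x - v x) b) + q (max (u x - v x - b) 0))) = v + a' + d'"
    unfolding fun_eq_iff
    using lr_w by (simp_all add: a_def a'_def d_def d'_def algebra_simps) (simp_all add: l_def r_def w_def algebra_simps)
  have saturated: "(0 \<le> r x \<and> l x = b) \<or> (r x = 0 \<and> l x \<le> b)" for x
    by (auto simp: l_def r_def)
  have p0: "p 0 = 0" and q0: "q 0 = 0"
    using p(2) q(2) by (simp_all add: normal_contraction_zero)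
  have pb: "0 \<le> p b" "p b \<le> b"
    using monoD[OF p(1) b] normal_contraction_abs_le[OF p(2), of b] b p0 by auto
  have p_le: "p x \<le> p b" "x - p x \<le> b - p b" if "x \<le> b" for x
    using monoD[OF p(1) that] normal_contraction_dist[OF p(2), of b x] that by auto
  have q_le: "0 \<le> q x" "q x \<le> x" if "0 \<le> x" for x
    using monoD[OF q(1) that] normal_contraction_abs_le[OF q(2), of x] that q0 by auto
  have lr: "E (z + l) + E (z + r) \<le> E z + E (z + l + r)" if "z \<in> L2 M" for z
  proof (rule admissible_split[OF cut[of b]])
    show "min (l x + r x) b = l x" for x
      using saturated[of x] b by auto
  qed (use that L2 b in auto)
  have a_d: "E (z + a) + E (z + d) \<le> E z + E (z + a + d)" if "z \<in> L2 M" for z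
  proof (rule admissible_split[OF cut[of "p b"]])
    show "min (a x + d x) (p b) = a x" for x
      using saturated[of x] p_le[of "l x"] q_le[of "r x"] q0 by (auto simp: a_def d_def)
  qed (use that L2 pb in auto)
  have a_d': "E (z + a) + E (z + d') \<le> E z + E (z + a + d')" if "z \<in> L2 M" for z
  proof (rule admissible_split[OF cut[of "p b"]])
    show "min (a x + d' x) (p b) = a x" for x
      using saturated[of x] p_le[of "l x"] q_le[of "r x"] q0 by (auto simp: a_def d'_def)
  qed (use that L2 pb in auto)
  have a'_d: "E (z + a') + E (z + d) \<le> E z + E (z + a' + d)" if "z \<in> L2 M" for z
  proof (rule admissible_split[OF cut[of "b - p b"]])
    show "min (a' x + d x) (b - p b) = a' x" for x
      using saturated[of x] p_le[of "l x"] q_le[of "r x"] q0 by (auto simp: a'_def d_def)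
  qed (use that L2 pb in auto)
  have a_a': "E (z + a) + E (z + a') \<le> E z + E (z + l)" if "z \<in> L2 M" for z
    unfolding sums(1)[symmetric] add.assoc[symmetric]
    by (rule admissible_split[OF p(3)]) (use that L2 in \<open>auto simp: a_def a'_def\<close>)
  have d_d': "E (z + d) + E (z + d') \<le> E z + E (z + r)" if "z \<in> L2 M" for z
    unfolding sums(2)[symmetric] add.assoc[symmetric]
    by (rule admissible_split[OF q(3)]) (use that L2 in \<open>auto simp: d_def d'_def\<close>)
  show "E (\<lambda>x. u x - (p (min (u x - v x) b) + q (max (u x - v x - b) 0)))
      + E (\<lambda>x. v x + (p (min (u x - v x) b) + q (max (u x - v x - b) 0))) \<le> E u + E v"
  proof (cases "E u < \<infinity> \<and> E v < \<infinity>")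
    case True
    then have fin: "E u < \<infinity>" "E v < \<infinity>"
      by auto
    (* i2, i5, i7 and i8 add up to the claim; the others only provide the finiteness of the
       terms that cancel. *)
    have i1: "E (v + l) + E (v + r) \<le> E v + E u"
      using lr[OF uv(2)] by (simp only: sums)
    have i2: "E (v + a) + E (v + a') \<le> E v + E (v + l)"
      by (rule a_a'[OF uv(2)])
    have i3: "E (v + l + d) + E (v + l + d') \<le> E (v + l) + E u"
      using d_d'[OF L2_add[OF uv(2) l]] by (simp only: sums)
    have i4: "E (v + r + a) + E (v + r + a') \<le> E (v + r) + E u"
    proof -
      have "v + r + l = u"
        by (simp only: sums(3)[symmetric] ac_simps)
      then show ?thesis
        using a_a'[OF L2_add[OF uv(2) r]] by simp
    qed
    have i5: "E (v + l) + E (v + a + d) \<le> E (v + a) + E (v + l + d)"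
      using a'_d[OF L2_add[OF uv(2) a]] by (simp add: sums(1)[symmetric] ac_simps)
    have i6: "E (v + l) + E (v + a' + d) \<le> E (v + a') + E (v + l + d)"
      using a_d[OF L2_add[OF uv(2) a']] by (simp add: sums(1)[symmetric] ac_simps)
    have i7: "E (v + l + d) + E (v + r + a') \<le> E (v + a' + d) + E u"
      using a_d'[OF L2_add[OF L2_add[OF uv(2) a'] d]]
      by (simp add: sums(1,2,3)[symmetric] ac_simps)
    have i8: "E (v + a' + d) + E (v + a' + d') \<le> E (v + a') + E (v + r + a')"
      using d_d'[OF L2_add[OF uv(2) a']] by (simp add: ac_simps)
    note f1 = ennreal_sum_leD[OF i1 fin(2,1)]
    note f2 = ennreal_sum_leD[OF i2 fin(2) f1(1)]
    note f3 = ennreal_sum_leD[OF i3 f1(1) fin(1)]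
    note f4 = ennreal_sum_leD[OF i4 f1(2) fin(1)]
    note f5 = ennreal_sum_leD[OF i5 f2(1) f3(1)]
    note f6 = ennreal_sum_leD[OF i6 f2(2) f3(1)]
    note f7 = ennreal_sum_leD[OF i7 f6(2) fin(1)]
    note f8 = ennreal_sum_leD[OF i8 f2(2) f4(2)]
    show ?thesis
      unfolding targets
      by (subst add.commute, rule ennreal_sum_leI) (use fin f5(2) f8(2) f2(3) f5(3) f7(3) f8(3) in \<open>auto\<close>)
  qed (auto simp: not_less top_unique)
qed

section \<open>Nonlinear Dirichlet forms admit all increasing contractions\<close>

definition truncation :: "real \<Rightarrow> real \<Rightarrow> real" where
  "truncation \<alpha> x = max (- \<alpha>) (min x \<alpha>)"

text \<open>
  The first inequality of a nonlinear Dirichlet form transfers \<open>(u - v)\<^sub>+ / 2\<close>, that is, it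
  moves both functions to their mean where \<open>u > v\<close>.
\<close>

lemma half_pos_part_admissible_iff:
  "admissible_transfer M E (\<lambda>x. max x 0 / 2) \<longleftrightarrow> (\<forall>u\<in>L2 M. \<forall>v\<in>L2 M.
     E (\<lambda>x. (u x + min (u x) (v x)) / 2) + E (\<lambda>x. (v x + max (u x) (v x)) / 2) \<le> E u + E v)"
proof -
  have "(\<lambda>x. u x - max (u x - v x) 0 / 2) = (\<lambda>x. (u x + min (u x) (v x)) / 2)"
    "(\<lambda>x. v x + max (u x - v x) 0 / 2) = (\<lambda>x. (v x + max (u x) (v x)) / 2)" for u v :: "'a \<Rightarrow> real"
    by (auto simp: fun_eq_iff min_def max_def field_simps)
  then show ?thesis
    unfolding admissible_transfer_def by simp
qed

text \<open>
  The second inequality transfers \<open>(x + truncation \<alpha> x) / 2\<close> with \<open>x = u - v\<close>, up to exchanging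
  the two resulting functions. The complementary transfer is the form to which the reflection
  lemma applies.
\<close>

lemma half_excess_admissible_iff:
  assumes \<alpha>: "0 < \<alpha>"
  shows "admissible_transfer M E (\<lambda>x. (x - truncation \<alpha> x) / 2) \<longleftrightarrow>
    (\<forall>u\<in>L2 M. \<forall>v\<in>L2 M. E (P1 \<alpha> u v) + E (P2 \<alpha> u v) \<le> E u + E v)"
proof -
  have parts: "pos_part (t + \<alpha>) - neg_part (t - \<alpha>) = t + truncation \<alpha> t" for t
    using \<alpha> by (auto simp: pos_part_def neg_part_def truncation_def max_def min_def)
  have "(\<lambda>x. u x - (u x - v x - truncation \<alpha> (u x - v x)) / 2) = P1 \<alpha> u v"
    "(\<lambda>x. v x + (u x - v x - truncation \<alpha> (u x - v x)) / 2) = P2 \<alpha> u v" for u v :: "'a \<Rightarrow> real"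
    unfolding P1_def P2_def parts by (simp_all add: fun_eq_iff field_simps)
  then show ?thesis
    unfolding admissible_transfer_def by simp
qed

lemma nonlinear_Dirichlet_form_iff_admissible:
  "nonlinear_Dirichlet_form M E \<longleftrightarrow>
     proper_functional M E \<and> lsc_functional M E \<and> convex_functional M E \<and>
     admissible_transfer M E (\<lambda>x. max x 0 / 2) \<and>
     (\<forall>\<alpha>>0. admissible_transfer M E (\<lambda>x. (x - truncation \<alpha> x) / 2))"
  unfolding nonlinear_Dirichlet_form_def half_pos_part_admissible_iff
  using half_excess_admissible_iff[of _ M E] by blast

text \<open>
  The truncation of a point does not change when the point moves towards its truncation or away from
  it on the same side. This is the retraction property that the excess \<open>x - truncation \<alpha> x\<close> needs.
\<close>

lemma truncation_outside:
  assumes "0 < \<alpha>" "0 \<le> h"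
  shows "truncation \<alpha> (truncation \<alpha> x + h * (x - truncation \<alpha> x)) = truncation \<alpha> x"
proof -
  consider "\<alpha> < x" | "x < - \<alpha>" | "- \<alpha> \<le> x" "x \<le> \<alpha>"
    by linarith
  then show ?thesis
  proof cases
    case 1
    then have "0 \<le> h * (x - \<alpha>)"
      using assms by simp
    with 1 assms show ?thesis
      by (simp add: truncation_def)
  next
    case 2
    then have "h * (x + \<alpha>) \<le> 0"
      using assms by (simp add: mult_nonneg_nonpos)
    with 2 assms show ?thesis
      by (simp add: truncation_def)
  qed (simp add: truncation_def)
qed

text \<open>
  Reflection makes \<open>max x 0\<close> and \<open>x - truncation \<beta> x\<close> admissible, hence also their complements
  \<open>min x 0\<close> and \<open>truncation \<beta>\<close>. The cut at \<open>\<beta>\<close> is the identity below \<open>0\<close> pasted to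
  \<open>truncation \<beta>\<close> above \<open>0\<close>; pasting at \<open>0\<close> uses only the cut at \<open>0\<close>, so there is no circularity.
\<close>

lemma admissible_cut:
  assumes E: "nonlinear_Dirichlet_form M E" and \<beta>: "0 \<le> \<beta>"
  shows "admissible_transfer M E (\<lambda>x. min x \<beta>)"
proof -
  from E have lsc: "lsc_functional M E"
    and half_pos: "admissible_transfer M E (\<lambda>x. max x 0 / 2)"
    and half_excess: "\<And>\<alpha>. 0 < \<alpha> \<Longrightarrow> admissible_transfer M E (\<lambda>x. (x - truncation \<alpha> x) / 2)"
    by (auto simp: nonlinear_Dirichlet_form_iff_admissible)
  have "admissible_transfer M E (\<lambda>x. max x 0)"
    by (rule admissible_reflection[OF lsc _ half_pos])
      (auto intro!: normal_contractionI simp: max_def mult_le_0_iff zero_le_mult_iff)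
  from admissible_complement[OF this]
  have cut_0: "admissible_transfer M E (\<lambda>x. min x 0)"
    by (rule back_subst[of "admissible_transfer M E"]) auto
  show ?thesis
  proof (cases "\<beta> = 0")
    case False
    with \<beta> have \<beta>: "0 < \<beta>"
      by simp
    have "admissible_transfer M E (\<lambda>x. x - truncation \<beta> x)"
    proof (rule admissible_reflection[OF lsc _ half_excess[OF \<beta>]])
      show "normal_contraction (\<lambda>x. x - truncation \<beta> x)"
        using \<beta> by (intro normal_contractionI) (auto simp: truncation_def max_def min_def)
      show "x - (x - truncation \<beta> x) + h * (x - truncation \<beta> x) - truncation \<beta> (x - (x - truncation \<beta> x) + h * (x - truncation \<beta> x))
          = h * (x - truncation \<beta> x)" if "0 \<le> h" for x h
        using truncation_outside[OF \<beta> that, of x] by simp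
    qed
    from admissible_complement[OF this] have "admissible_transfer M E (truncation \<beta>)"
      by simp
    moreover have "mono (truncation \<beta>) \<and> normal_contraction (truncation \<beta>)"
      using \<beta> by (intro mono_contractionI) (auto simp: truncation_def)
    ultimately have "admissible_transfer M E (\<lambda>x. min x 0 + truncation \<beta> (max (x - 0) 0))"
      using mono_contraction_linear[of 1] admissible_id[of M E]
      by (intro admissible_concatenation[where b = 0]) (auto intro: cut_0)
    then show ?thesis
      by (rule back_subst[of "admissible_transfer M E"])
        (use \<beta> in \<open>auto simp: fun_eq_iff truncation_def min_def max_def\<close>)
  qed (use cut_0 in simp)
qed

text \<open>
  The approximation interpolates \<open>p\<close> linearly at the multiples of \<open>\<epsilon>\<close>. On a cell of length \<open>\<epsilon>\<close>
  both \<open>p\<close> and its interpolation increase between the same two values, which differ by at most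
  \<open>\<epsilon>\<close>. The induction pastes the first linear piece to an approximation of \<open>p\<close> shifted to the
  origin.
\<close>

lemma admissible_approximation_right:
  assumes E: "nonlinear_Dirichlet_form M E" and \<epsilon>: "0 < \<epsilon>"
    and p: "mono p" "normal_contraction p"
  shows "\<exists>q. mono q \<and> normal_contraction q \<and> admissible_transfer M E q \<and>
    (\<forall>x\<in>{0..real n * \<epsilon>}. \<bar>q x - p x\<bar> \<le> \<epsilon>)"
  using p
proof (induction n arbitrary: p)
  case 0
  \<comment> \<open>The interval is the point \<open>0\<close>, where every normal contraction agrees with \<open>p\<close>.\<close>
  show ?case
    using 0 \<epsilon> mono_contraction_linear[of 1] admissible_id[of M E]
    by (intro exI[of _ "\<lambda>x. x"]) (simp add: normal_contraction_zero)
next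
  case (Suc n)
  define c where "c = p \<epsilon> / \<epsilon>"
  have p\<epsilon>: "0 \<le> p \<epsilon>" "p \<epsilon> \<le> \<epsilon>"
    using mono_contractionD[OF Suc.prems, of 0 \<epsilon>] \<epsilon> Suc.prems by (auto simp: normal_contraction_zero)
  then have c: "0 \<le> c" "c \<le> 1"
    using \<epsilon> by (auto simp: c_def)
  have "mono (\<lambda>x. p (x + \<epsilon>) - p \<epsilon>) \<and> normal_contraction (\<lambda>x. p (x + \<epsilon>) - p \<epsilon>)"
  proof (rule mono_contractionI)
    show "p (x + \<epsilon>) - p \<epsilon> \<le> p (y + \<epsilon>) - p \<epsilon> \<and> p (y + \<epsilon>) - p \<epsilon> - (p (x + \<epsilon>) - p \<epsilon>) \<le> y - x"
      if "x \<le> y" for x y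
      using mono_contractionD[OF Suc.prems, of "x + \<epsilon>" "y + \<epsilon>"] that by auto
  qed simp
  with Suc.IH obtain q where q: "mono q" "normal_contraction q" "admissible_transfer M E q"
    and approx: "\<And>x. 0 \<le> x \<Longrightarrow> x \<le> real n * \<epsilon> \<Longrightarrow> \<bar>q x - (p (x + \<epsilon>) - p \<epsilon>)\<bar> \<le> \<epsilon>"
    by (metis atLeastAtMost_iff)
  note lin = mono_contraction_linear[OF c]
  define r where "r x = c * min x \<epsilon> + q (max (x - \<epsilon>) 0)" for x
  have "admissible_transfer M E r"
    unfolding r_def using E \<epsilon> lin q c
    by (intro admissible_concatenation admissible_cut admissible_linear)
      (auto simp: nonlinear_Dirichlet_form_def)
  moreover have "mono r \<and> normal_contraction r"
    unfolding r_def using lin q \<epsilon> by (intro mono_contraction_concatenation) auto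
  moreover have "\<bar>r x - p x\<bar> \<le> \<epsilon>" if x: "0 \<le> x" "x \<le> real (Suc n) * \<epsilon>" for x
  proof (cases "x \<le> \<epsilon>")
    case True
    then have "0 \<le> c * x" "c * x \<le> c * \<epsilon>"
      using c x by (auto intro: mult_left_mono)
    moreover have "0 \<le> p x" "p x \<le> p \<epsilon>"
      using mono_contractionD[OF Suc.prems] x True normal_contraction_zero[OF Suc.prems(2)] by metis+
    moreover have "c * \<epsilon> = p \<epsilon>" "r x = c * x"
      using True \<epsilon> q by (auto simp: c_def r_def normal_contraction_zero)
    ultimately show ?thesis
      using p\<epsilon> by linarith
  next
    case False
    then have "r x = p \<epsilon> + q (x - \<epsilon>)"
      using \<epsilon> by (simp add: r_def c_def)
    moreover have "\<bar>q (x - \<epsilon>) - (p x - p \<epsilon>)\<bar> \<le> \<epsilon>"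
      using approx[of "x - \<epsilon>"] x False by (simp add: algebra_simps)
    ultimately show ?thesis
      by (simp add: algebra_simps)
  qed
  ultimately show ?case
    by auto
qed

text \<open>
  The left half is the mirror image of a right approximation to the mirror image of \<open>p\<close>, and the
  halves are pasted at \<open>0\<close>.
\<close>

lemma admissible_approximation:
  assumes E: "nonlinear_Dirichlet_form M E" and \<epsilon>: "0 < \<epsilon>"
    and p: "mono p" "normal_contraction p"
  shows "\<exists>q. normal_contraction q \<and> admissible_transfer M E q \<and>
    (\<forall>x. \<bar>x\<bar> \<le> real n * \<epsilon> \<longrightarrow> \<bar>q x - p x\<bar> \<le> \<epsilon>)"
proof -
  obtain r where r: "mono r" "normal_contraction r" "admissible_transfer M E r"
    and r_approx: "\<And>x. 0 \<le> x \<Longrightarrow> x \<le> real n * \<epsilon> \<Longrightarrow> \<bar>r x - p x\<bar> \<le> \<epsilon>"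
    using admissible_approximation_right[OF E \<epsilon> p, of n] by auto
  obtain s where s: "mono s" "normal_contraction s" "admissible_transfer M E s"
    and s_approx: "\<And>x. 0 \<le> x \<Longrightarrow> x \<le> real n * \<epsilon> \<Longrightarrow> \<bar>s x - (- p (- x))\<bar> \<le> \<epsilon>"
    using admissible_approximation_right[OF E \<epsilon>, of "\<lambda>x. - p (- x)" n] mono_contraction_mirror[OF p]
    by auto
  define l where "l x = - s (- x)" for x
  have l: "mono l" "normal_contraction l" "admissible_transfer M E l"
    using mono_contraction_mirror[OF s(1,2)] admissible_mirror[OF s(3)] by (simp_all add: l_def[abs_def])
  define q where "q x = l (min x 0) + r (max (x - 0) 0)" for x
  have "admissible_transfer M E q"
    unfolding q_def using l r by (intro admissible_concatenation admissible_cut[OF E]) auto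
  moreover have "normal_contraction q"
    unfolding q_def using mono_contraction_concatenation[OF l(1,2) r(1,2), of 0] by simp
  moreover have "\<bar>q x - p x\<bar> \<le> \<epsilon>" if x: "\<bar>x\<bar> \<le> real n * \<epsilon>" for x
  proof (cases "0 \<le> x")
    case True
    then show ?thesis
      using r_approx[of x] x l by (simp add: q_def normal_contraction_zero)
  next
    case False
    then show ?thesis
      using s_approx[of "- x"] x r by (simp add: q_def l_def normal_contraction_zero)
  qed
  ultimately show ?thesis
    by auto
qed

text \<open>
  Mesh size \<open>\<epsilon> k = 1 / (k + 1)\<close> with \<open>(k + 1)\<^sup>2\<close> cells on either side of \<open>0\<close> approximates \<open>p\<close> to
  within \<open>\<epsilon> k\<close> on \<open>[-(k + 1), k + 1]\<close>, so the approximations converge everywhere.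
\<close>

lemma nonlinear_Dirichlet_form_admissible:
  assumes E: "nonlinear_Dirichlet_form M E" and p: "mono p" "normal_contraction p"
  shows "admissible_transfer M E p"
proof -
  define \<epsilon> :: "nat \<Rightarrow> real" where "\<epsilon> k = inverse (real (Suc k))" for k
  have "\<exists>q. normal_contraction q \<and> admissible_transfer M E q \<and>
      (\<forall>x. \<bar>x\<bar> \<le> real (Suc k) \<longrightarrow> \<bar>q x - p x\<bar> \<le> \<epsilon> k)" for k
  proof -
    have "real (Suc k * Suc k) * \<epsilon> k = real (Suc k)"
      by (simp add: \<epsilon>_def field_simps)
    then show ?thesis
      using admissible_approximation[OF E _ p, of "\<epsilon> k" "Suc k * Suc k"] by (simp add: \<epsilon>_def)
  qed
  then obtain q where q: "\<And>k. normal_contraction (q k)" "\<And>k. admissible_transfer M E (q k)"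
    and approx: "\<And>k x. \<bar>x\<bar> \<le> real (Suc k) \<Longrightarrow> \<bar>q k x - p x\<bar> \<le> \<epsilon> k"
    by metis
  have "(\<lambda>k. q k x) \<longlonglongrightarrow> p x" for x
  proof (rule Lim_transform_bound[of _ \<epsilon>, THEN LIM_zero_cancel])
    obtain N where "\<bar>x\<bar> \<le> real N"
      using real_arch_simple by blast
    then show "\<forall>\<^sub>F k in sequentially. norm (q k x - p x) \<le> norm (\<epsilon> k)"
      using approx unfolding eventually_sequentially
      by (intro exI[of _ N]) (auto intro!: order_trans[OF _ abs_ge_self] approx)
    show "\<epsilon> \<longlonglongrightarrow> 0"
      unfolding \<epsilon>_def by (rule LIMSEQ_inverse_real_of_nat)
  qed
  with E q p show ?thesis
    by (intro admissible_limit[of M E p q]) (auto simp: nonlinear_Dirichlet_form_def)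
qed

section \<open>The contraction property and its consequences\<close>

lemma contraction_property_iff_admissible:
  "contraction_property M E \<longleftrightarrow>
    (\<forall>p. mono p \<and> normal_contraction p \<longrightarrow> admissible_transfer M E p)"
proof (intro iffI allI impI)
  fix p :: "real \<Rightarrow> real"
  assume E: "contraction_property M E" and p: "mono p \<and> normal_contraction p"
  have C: "normal_contraction (\<lambda>x. x - p (2 * x))"
  proof (rule normal_contractionI)
    show "\<bar>y - p (2 * y) - (x - p (2 * x))\<bar> \<le> y - x" if "x \<le> y" for x y
      using mono_contractionD[of p "2 * x" "2 * y"] p that by auto
  qed (use p in \<open>simp add: normal_contraction_zero\<close>)
  show "admissible_transfer M E p"
    unfolding admissible_transfer_def
  proof (intro ballI)
    fix u v assume uv: "u \<in> L2 M" "v \<in> L2 M"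
    define f where "f = (\<lambda>x. 1/2 * (u + v) x)"
    define g where "g = (\<lambda>x. 1/2 * (u - v) x)"
    have "f \<in> L2 M" "g \<in> L2 M"
      unfolding f_def g_def by (intro L2_scale L2_add L2_diff uv)+
    with E C have "E (\<lambda>x. f x + (g x - p (2 * g x))) + E (\<lambda>x. f x - (g x - p (2 * g x)))
        \<le> E (\<lambda>x. f x + g x) + E (\<lambda>x. f x - g x)"
      unfolding contraction_property_def by blast
    moreover have "2 * g x = u x - v x" "f x + g x = u x" "f x - g x = v x"
      "f x + (g x - y) = u x - y" "f x - (g x - y) = v x + y" for x y
      by (simp_all add: f_def g_def field_simps)
    ultimately show "E (\<lambda>x. u x - p (u x - v x)) + E (\<lambda>x. v x + p (u x - v x)) \<le> E u + E v"
      by simp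
  qed
next
  assume adm: "\<forall>p. mono p \<and> normal_contraction p \<longrightarrow> admissible_transfer M E p"
  show "contraction_property M E"
    unfolding contraction_property_def
  proof (intro allI impI ballI)
    fix C f g assume C: "normal_contraction C" and fg: "f \<in> L2 M" "g \<in> L2 M"
    define p where "p x = x / 2 - C (x / 2)" for x
    have "mono p \<and> normal_contraction p"
    proof (rule mono_contractionI)
      show "p x \<le> p y \<and> p y - p x \<le> y - x" if "x \<le> y" for x y
        using normal_contraction_dist[OF C, of "x / 2" "y / 2"] that
        unfolding p_def by (intro conjI; linarith)
    qed (use C in \<open>simp add: p_def normal_contraction_zero\<close>)
    with adm admissible_transferD[OF _ L2_add[OF fg] L2_diff[OF fg], of E p]
    show "E (\<lambda>x. f x + C (g x)) + E (\<lambda>x. f x - C (g x)) \<le> E (\<lambda>x. f x + g x) + E (\<lambda>x. f x - g x)"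
      by (simp add: p_def plus_fun_def fun_diff_def)
  qed
qed

text \<open>
  One of the endpoints and a point of the interval have \<open>t\<close> as their midpoint, so any upper bound
  of \<open>\<phi>\<close> can be halved, and hence tends to \<open>0\<close> on iteration.
\<close>

lemma bounded_midpoint_convex_nonpos:
  fixes \<phi> :: "real \<Rightarrow> real"
  assumes bound: "\<And>t. t \<in> {0..1} \<Longrightarrow> \<phi> t \<le> K" and ends: "\<phi> 0 \<le> 0" "\<phi> 1 \<le> 0"
    and mid: "\<And>s t. s \<in> {0..1} \<Longrightarrow> t \<in> {0..1} \<Longrightarrow> 2 * \<phi> ((s + t) / 2) \<le> \<phi> s + \<phi> t"
    and t: "t \<in> {0..1}"
  shows "\<phi> t \<le> 0"
proof -
  have le: "\<phi> t \<le> K * (1/2)^n" if "t \<in> {0..1}" for n t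
    using that
  proof (induction n arbitrary: t)
    case 0
    then show ?case
      using bound by simp
  next
    case (Suc n)
    have "2 * \<phi> t \<le> K * (1/2)^n"
    proof (cases "t \<le> 1/2")
      case True
      with Suc.prems Suc.IH[of "2 * t"] mid[of 0 "2 * t"] ends show ?thesis
        by auto
    next
      case False
      with Suc.prems Suc.IH[of "2 * t - 1"] mid[of "2 * t - 1" 1] ends show ?thesis
        by auto
    qed
    then show ?case
      by simp
  qed
  have "(\<lambda>n. K * (1/2)^n) \<longlonglongrightarrow> K * 0"
    by (intro tendsto_mult tendsto_const LIMSEQ_power_zero) simp
  from LIMSEQ_le_const[OF this, of "\<phi> t"] le[OF t] show ?thesis
    by simp
qed

text \<open>
  Along the segment from \<open>f\<close> to \<open>g\<close>, the deviation \<open>\<phi>\<close> of \<open>E\<close> from its chord is bounded above, by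
  the transfers \<open>s * x\<close>, and midpoint convex, by the transfer \<open>x / 2\<close>, so it is nonpositive.
\<close>

lemma convex_if_admissible:
  assumes adm: "\<And>p. mono p \<Longrightarrow> normal_contraction p \<Longrightarrow> admissible_transfer M E p"
  shows "convex_functional M E"
  unfolding convex_functional_def
proof (intro ballI)
  fix f g and t :: real assume f: "f \<in> L2 M" and g: "g \<in> L2 M" and t: "t \<in> {0..1}"
  define G where "G s = (\<lambda>x. (1 - s) * f x + s * g x)" for s
  have G: "G s \<in> L2 M" for s
    using L2_add[OF L2_scale[OF f] L2_scale[OF g]] by (simp add: G_def plus_fun_def)
  have lin: "admissible_transfer M E (\<lambda>x. s * x)" if "s \<in> {0..1}" for s
    using mono_contraction_linear[of s] that by (simp add: adm)
  show "E (\<lambda>x. (1 - t) * f x + t * g x) \<le> ennreal (1 - t) * E f + ennreal t * E g"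
  proof (cases "E f < \<infinity> \<and> E g < \<infinity>")
    case True
    define \<phi> where "\<phi> s = enn2real (E (G s)) - ((1 - s) * enn2real (E f) + s * enn2real (E g))" for s
    have G01: "G 0 = f" "G 1 = g"
      by (simp_all add: G_def)
    have seg: "E (G s) + E (G (1 - s)) \<le> E f + E g" if "s \<in> {0..1}" for s
      using admissible_transferD[OF lin[OF that] f g] by (simp add: G_def algebra_simps)
    have fin: "E (G s) < \<infinity>" and bound: "enn2real (E (G s)) \<le> enn2real (E f) + enn2real (E g)"
      if "s \<in> {0..1}" for s
    proof -
      show "E (G s) < \<infinity>"
        using ennreal_sum_leD(1)[OF seg[OF that]] True by blast
      have "enn2real (E (G s)) + enn2real (E (G (1 - s))) \<le> enn2real (E f) + enn2real (E g)"
        using ennreal_sum_leD(3)[OF seg[OF that]] True by blast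
      then show "enn2real (E (G s)) \<le> enn2real (E f) + enn2real (E g)"
        using enn2real_nonneg[of "E (G (1 - s))"] by linarith
    qed
    have "\<phi> t \<le> 0"
    proof (rule bounded_midpoint_convex_nonpos[OF _ _ _ _ t])
      show "\<phi> s \<le> enn2real (E f) + enn2real (E g)" if "s \<in> {0..1}" for s
      proof -
        have "0 \<le> (1 - s) * enn2real (E f) + s * enn2real (E g)"
          using that by (intro add_nonneg_nonneg mult_nonneg_nonneg) auto
        then show ?thesis
          using bound[OF that] by (simp add: \<phi>_def)
      qed
      show "\<phi> 0 \<le> 0" "\<phi> 1 \<le> 0"
        by (simp_all add: \<phi>_def G01)
      fix r s :: real assume rs: "r \<in> {0..1}" "s \<in> {0..1}"
      have "(\<lambda>x. G r x - 1/2 * (G r x - G s x)) = G ((r + s) / 2)"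
        "(\<lambda>x. G s x + 1/2 * (G r x - G s x)) = G ((r + s) / 2)"
        by (auto simp: G_def fun_eq_iff field_simps)
      then have "E (G ((r + s) / 2)) + E (G ((r + s) / 2)) \<le> E (G r) + E (G s)"
        using admissible_transferD[OF lin[of "1/2"] G[of r] G[of s]] by simp
      from ennreal_sum_leD(3)[OF this fin[OF rs(1)] fin[OF rs(2)]]
      show "2 * \<phi> ((r + s) / 2) \<le> \<phi> r + \<phi> s"
        by (simp add: \<phi>_def field_simps)
    qed
    then have "enn2real (E (G t)) \<le> (1 - t) * enn2real (E f) + t * enn2real (E g)"
      by (simp add: \<phi>_def)
    then have "ennreal (enn2real (E (G t))) \<le> ennreal ((1 - t) * enn2real (E f) + t * enn2real (E g))"
      by (rule ennreal_leI)
    also have "\<dots> = ennreal (1 - t) * E f + ennreal t * E g"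
      using t True by (simp add: ennreal_plus ennreal_mult)
    finally show ?thesis
      using fin[OF t] by (simp add: G_def)
  next
    case False
    consider "t = 0" | "t = 1" | "0 < t" "t < 1"
      using t by fastforce
    then show ?thesis
    proof cases
      case 3
      then have "ennreal (1 - t) * E f + ennreal t * E g = \<infinity>"
        using False by (auto simp: ennreal_mult_eq_top_iff not_less top_unique)
      then show ?thesis
        by (simp only: infinity_ennreal_def top_greatest)
    qed simp_all
  qed
qed

lemma nonlinear_Dirichlet_form_if_admissible:
  assumes proper: "proper_functional M E" and lsc: "lsc_functional M E"
    and adm: "\<And>p. mono p \<Longrightarrow> normal_contraction p \<Longrightarrow> admissible_transfer M E p"
  shows "nonlinear_Dirichlet_form M E"
  unfolding nonlinear_Dirichlet_form_iff_admissible
proof (intro conjI allI impI proper lsc convex_if_admissible adm)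
  have "mono (\<lambda>x::real. max x 0 / 2) \<and> normal_contraction (\<lambda>x. max x 0 / 2)"
    by (rule mono_contractionI) (auto simp: max_def)
  then show "mono (\<lambda>x::real. max x 0 / 2)" "normal_contraction (\<lambda>x. max x 0 / 2)"
    by auto
  fix \<alpha> :: real assume \<alpha>: "0 < \<alpha>"
  have "mono (\<lambda>x. (x - truncation \<alpha> x) / 2) \<and> normal_contraction (\<lambda>x. (x - truncation \<alpha> x) / 2)"
    using \<alpha> by (intro mono_contractionI) (auto simp: truncation_def max_def min_def field_simps)
  then show "mono (\<lambda>x. (x - truncation \<alpha> x) / 2)" "normal_contraction (\<lambda>x. (x - truncation \<alpha> x) / 2)"
    by auto
qed

theorem theorem1:
  fixes M :: "'a measure" and E :: "('a \<Rightarrow> real) \<Rightarrow> ennreal"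
  assumes "L2_functional M E"
    and "proper_functional M E"
    and "lsc_functional M E"
  shows "((\<forall>p. mono p \<and> normal_contraction p \<longrightarrow> (\<forall>u\<in>L2 M. \<forall>v\<in>L2 M.
            E (\<lambda>x. u x - p (u x - v x)) + E (\<lambda>x. v x + p (u x - v x)) \<le> E u + E v))
          \<longleftrightarrow> contraction_property M E)
       \<and> (contraction_property M E \<longleftrightarrow> nonlinear_Dirichlet_form M E)"
proof
  show "(\<forall>p. mono p \<and> normal_contraction p \<longrightarrow> (\<forall>u\<in>L2 M. \<forall>v\<in>L2 M.
            E (\<lambda>x. u x - p (u x - v x)) + E (\<lambda>x. v x + p (u x - v x)) \<le> E u + E v))
          \<longleftrightarrow> contraction_property M E"
    unfolding contraction_property_iff_admissible admissible_transfer_def ..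
  show "contraction_property M E \<longleftrightarrow> nonlinear_Dirichlet_form M E"
    unfolding contraction_property_iff_admissible
    using nonlinear_Dirichlet_form_admissible nonlinear_Dirichlet_form_if_admissible[OF assms(2,3)]
    by blast
qed

end
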